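(* Let $a_n = \ln\left(1+\frac{1}{n+1}\right)$ for all integers $n\ge 0$. Then the terraced matrix $M = M(a)$ generated by the sequence $a=\{a_n\}_{n\ge 0}$ is a hyponormal operator on $\ell^2$.
   Context: $\ell^2$ denotes the Hilbert space of square-summable complex sequences indexed by the nonnegative integers. For a sequence $a=\{a_n\}_{n\ge 0}$ of complex numbers, the terraced matrix $M(a)$ generated by $a$ is the lower triangular infinite matrix with constant row segments, i.e. the matrix with entries $m_{nj}=a_n$ for $0\le j\le n$ and $m_{nj}=0$ for $j>n$ ($n,j\ge 0$); it acts on $\ell^2$ by matrix multiplication, $(Mf)_n = a_n\sum_{j=0}^n f_j$. A bounded linear operator $M$ on $\ell^2$ is hyponormal if $\langle (M^*M-MM^* )f,f\rangle\ge 0$ for all $f\in\ell^2$. Saying that a terraced matrix is a hyponormal operator on $\ell^2$ means that it acts as a bounded linear operator on $\ell^2$ and this operator is hyponormal. *)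

theory Defs
  imports "HOL-Analysis.Analysis"
begin

definition ell2 :: "(nat \<Rightarrow> complex) set" where
  "ell2 = {f. summable (\<lambda>n. (cmod (f n))\<^sup>2)}"

definition ell2_inner :: "(nat \<Rightarrow> complex) \<Rightarrow> (nat \<Rightarrow> complex) \<Rightarrow> complex" where
  "ell2_inner f g = (\<Sum>n. f n * cnj (g n))"

definition ell2_norm :: "(nat \<Rightarrow> complex) \<Rightarrow> real" where
  "ell2_norm f = sqrt (\<Sum>n. (cmod (f n))\<^sup>2)"

lemma ell2_inner_summable:
  assumes "f \<in> ell2" "g \<in> ell2"
  shows "summable (\<lambda>n. f n * cnj (g n))"
proof (rule summable_comparison_test')
  show "summable (\<lambda>n. (cmod (f n))\<^sup>2 + (cmod (g n))\<^sup>2)"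
    using assms by (auto simp: ell2_def intro: summable_add)
  fix n :: nat
  have "2 * (cmod (f n) * cmod (g n)) \<le> (cmod (f n))\<^sup>2 + (cmod (g n))\<^sup>2"
    using sum_squares_bound[of "cmod (f n)" "cmod (g n)"] by simp
  moreover have "0 \<le> cmod (f n) * cmod (g n)" by simp
  ultimately show "norm (f n * cnj (g n)) \<le> (cmod (f n))\<^sup>2 + (cmod (g n))\<^sup>2"
    unfolding norm_mult complex_mod_cnj by linarith
qed

text \<open>
  Operators on \<open>ell2\<close> are functions on all complex sequences; only their values on the carrier
  \<open>ell2\<close> matter.
\<close>

definition ell2_bounded_operator :: "((nat \<Rightarrow> complex) \<Rightarrow> (nat \<Rightarrow> complex)) \<Rightarrow> bool" where
  "ell2_bounded_operator T \<longleftrightarrow>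
     (\<forall>f\<in>ell2. T f \<in> ell2) \<and>
     (\<forall>f\<in>ell2. \<forall>g\<in>ell2. T (\<lambda>n. f n + g n) = (\<lambda>n. T f n + T g n)) \<and>
     (\<forall>c. \<forall>f\<in>ell2. T (\<lambda>n. c * f n) = (\<lambda>n. c * T f n)) \<and>
     (\<exists>K. \<forall>f\<in>ell2. ell2_norm (T f) \<le> K * ell2_norm f)"

text \<open>
  The description operator is applied separately to each \<open>g\<close>. For a bounded operator \<open>T\<close> and
  \<open>g \<in> ell2\<close> the described sequence exists by the Riesz representation theorem, and it is unique
  by the lemma that follows.
\<close>

definition ell2_adjoint ::
    "((nat \<Rightarrow> complex) \<Rightarrow> (nat \<Rightarrow> complex)) \<Rightarrow> (nat \<Rightarrow> complex) \<Rightarrow> (nat \<Rightarrow> complex)" where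
  "ell2_adjoint T g =
     (THE h. h \<in> ell2 \<and> (\<forall>f\<in>ell2. ell2_inner (T f) g = ell2_inner f h))"

lemma ell2_adjoint_unique:
  assumes "\<forall>f\<in>ell2. ell2_inner (T f) g = ell2_inner f h"
    and "\<forall>f\<in>ell2. ell2_inner (T f) g = ell2_inner f h'"
  shows "h = h'"
proof
  fix n
  define e :: "nat \<Rightarrow> complex" where "e k = (if k = n then 1 else 0)" for k
  have e: "e \<in> ell2"
    unfolding ell2_def mem_Collect_eq
    by (rule summable_finite[of "{n}"]) (auto simp: e_def)
  have inner_e: "ell2_inner e u = cnj (u n)" for u
    unfolding ell2_inner_def by (subst suminf_finite[of "{n}"]) (auto simp: e_def)
  have "ell2_inner e h = ell2_inner e h'" using assms e by metis
  then show "h n = h' n" by (simp add: inner_e)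
qed

definition ell2_hyponormal :: "((nat \<Rightarrow> complex) \<Rightarrow> (nat \<Rightarrow> complex)) \<Rightarrow> bool" where
  "ell2_hyponormal T \<longleftrightarrow>
     ell2_bounded_operator T \<and>
     (\<forall>f\<in>ell2. ell2_inner (\<lambda>n. ell2_adjoint T (T f) n - T (ell2_adjoint T f) n) f \<in> \<real>\<^sub>\<ge>\<^sub>0)"

definition matrix_op ::
    "(nat \<Rightarrow> nat \<Rightarrow> complex) \<Rightarrow> (nat \<Rightarrow> complex) \<Rightarrow> (nat \<Rightarrow> complex)" where
  "matrix_op A f n = (\<Sum>j. A n j * f j)"

definition terraced_matrix :: "(nat \<Rightarrow> complex) \<Rightarrow> nat \<Rightarrow> nat \<Rightarrow> complex" where
  "terraced_matrix a n j = (if j \<le> n then a n else 0)"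

lemma matrix_op_terraced_matrix:
  "matrix_op (terraced_matrix a) f n = a n * (\<Sum>j\<le>n. f j)"
  unfolding matrix_op_def
  by (subst suminf_finite[of "{..n}"]) (auto simp: terraced_matrix_def sum_distrib_left)

end

theory Submission
  imports Defs
begin

text \<open>
  The property of the logarithm behind the result is that the reciprocals \<open>b n = 1 / a n\<close> form a concave
  sequence, because \<open>x (x + 1) (ln (1 + 1/x))\<^sup>2\<close> is increasing and is the reciprocal of the
  derivative of \<open>1 / ln (1 + 1/x)\<close>. Terraced matrices with this property are hyponormal whenever
  \<open>b\<close> grows at least linearly and concavity persists after prepending the value \<open>0\<close>, that is,
  \<open>b 1 - b 0 \<le> b 0 - 0\<close>.

  Hyponormality means \<open>\<parallel>M\<^sup>* f\<parallel> \<le> \<parallel>M f\<parallel>\<close>. Let \<open>S n\<close> be the partial sums of \<open>f\<close>, so that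
  \<open>(M f) n = a n * S n\<close>, let \<open>t n = (M\<^sup>* f) n\<close> be the tail sums of \<open>a k * f k\<close>, and put
  \<open>V n = t (n + 1) + a n * S n\<close>. Both \<open>t (n + 1)\<close> and \<open>(M f) n\<close> can be expressed through \<open>V n\<close> and
  \<open>V (n + 1)\<close>: \<open>t (n + 1) = V n - a n * S n\<close> and \<open>V n - V (n + 1) = (a n - a (n + 1)) * S n\<close>.
  Completing the square gives, with \<open>w = b (n + 1) / (b (n + 1) - b n)\<close>,
  \<open>|t (n + 1)|\<^sup>2 + (w - 1) * |V n|\<^sup>2 + a n * (a n - a (n + 1)) * |S n|\<^sup>2
    = |(M f) n|\<^sup>2 + w * |V (n + 1)|\<^sup>2\<close>.
  Concavity of \<open>b\<close> says exactly that \<open>w - 1\<close> is at least the weight \<open>w\<close> of the preceding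
  index, so these relations telescope (\<open>weighted_step\<close>, \<open>weighted_inequality\<close>) and leave only a
  boundary term. After cutting \<open>f\<close> off at \<open>N\<close> the boundary term is at most a constant times
  \<open>N |(M f) N|\<^sup>2\<close>. It is arbitrarily small for suitable large \<open>N\<close>, since \<open>M f\<close> is square-summable by
  Hardy's inequality whereas the harmonic series diverges (\<open>Mstar_partial_sums_le\<close>).

  The same estimate shows that the tail sums of \<open>a k * f k\<close> are square-summable, which is what the
  identification of the adjoint by summation by parts needs (\<open>inner_M_Mstar\<close>).
\<close>

section \<open>Square-summable sequences\<close>

text \<open>
  The boundary terms at \<open>N\<close> are \<open>N\<close> times a term of a convergent series. They need not tend to
  \<open>0\<close>, but divergence of the harmonic series makes them small for arbitrarily large \<open>N\<close>, and
  this is enough wherever the other quantities have a limit.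
\<close>

lemma summable_weighted_infimum_0:
  fixes u :: "nat \<Rightarrow> real"
  assumes "summable u" "\<And>n. 0 \<le> u n" "0 < e"
  shows "\<exists>n\<ge>N. real (Suc n) * u n < e"
proof (rule ccontr)
  assume "\<not> ?thesis"
  then have le: "e \<le> real (Suc n) * u n" if "n \<ge> N" for n
    using that by (meson not_less)
  have "summable (\<lambda>n. e * inverse (real (Suc n)))"
  proof (rule summable_comparison_test'[OF assms(1), of N])
    fix n assume "n \<ge> N"
    from le[OF this] show "norm (e * inverse (real (Suc n))) \<le> u n"
      using \<open>0 < e\<close> by (simp add: field_simps)
  qed
  then have "summable (\<lambda>n. inverse (real (Suc n)))"
    using \<open>0 < e\<close> by (simp add: summable_cmult_iff)
  then have "summable (\<lambda>n. inverse (real n))"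
    by (subst (asm) summable_Suc_iff)
  then show False
    using not_summable_harmonic[where 'a=real] by simp
qed

lemma ell2_cnj:
  assumes "f \<in> ell2" shows "(\<lambda>n. cnj (f n)) \<in> ell2"
  using assms by (simp add: ell2_def)

lemma ell2_inner_cnj:
  assumes "f \<in> ell2" "g \<in> ell2"
  shows "ell2_inner g f = cnj (ell2_inner f g)"
proof -
  have "(\<lambda>n. f n * cnj (g n)) sums ell2_inner f g"
    unfolding ell2_inner_def by (intro summable_sums ell2_inner_summable assms)
  then have "(\<lambda>n. cnj (f n * cnj (g n))) sums cnj (ell2_inner f g)"
    by (simp only: sums_cnj)
  then show ?thesis
    unfolding ell2_inner_def[of g f] by (simp add: sums_iff mult.commute)
qed

lemma ell2_inner_self:
  assumes "f \<in> ell2"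
  shows "ell2_inner f f = complex_of_real (\<Sum>n. (cmod (f n))\<^sup>2)"
  using assms unfolding ell2_inner_def ell2_def
  by (simp add: suminf_of_real complex_norm_square flip: of_real_power)

lemma ell2_inner_diff_left:
  assumes "f \<in> ell2" "g \<in> ell2" "h \<in> ell2"
  shows "ell2_inner (\<lambda>n. f n - g n) h = ell2_inner f h - ell2_inner g h"
  unfolding ell2_inner_def
  by (simp add: left_diff_distrib suminf_diff ell2_inner_summable assms)

lemma ell2_bounded_partial_sums:
  assumes "\<And>N. (\<Sum>n\<le>N. (cmod (f n))\<^sup>2) \<le> B"
  shows "f \<in> ell2" "(\<Sum>n. (cmod (f n))\<^sup>2) \<le> B"
proof -
  have le: "(\<Sum>n<N. (cmod (f n))\<^sup>2) \<le> B" for N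
    by (rule order_trans[OF _ assms[of N]]) (auto intro: sum_mono2)
  then have "summable (\<lambda>n. (cmod (f n))\<^sup>2)"
    by (intro summableI_nonneg_bounded) auto
  then show "f \<in> ell2" "(\<Sum>n. (cmod (f n))\<^sup>2) \<le> B"
    using le by (auto simp: ell2_def intro: suminf_le_const)
qed

section \<open>Hardy's inequality\<close>

text \<open>
  With \<open>m n\<close> the mean of \<open>r 0, \<dots>, r n\<close>, the difference \<open>(m n)\<^sup>2 - 2 * m n * r n\<close> is at most the
  telescoping term \<open>n * (m (n - 1))\<^sup>2 - (n + 1) * (m n)\<^sup>2\<close>. Bounding \<open>2 * m n * r n\<close> by
  \<open>(m n)\<^sup>2 / 2 + 2 * (r n)\<^sup>2\<close> then yields the constant \<open>4\<close> without the Cauchy-Schwarz inequality.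
\<close>

lemma hardy_real:
  fixes r :: "nat \<Rightarrow> real"
  shows "(\<Sum>n\<le>N. ((\<Sum>j\<le>n. r j) / real (Suc n))\<^sup>2) \<le> 4 * (\<Sum>n\<le>N. (r n)\<^sup>2)"
proof -
  define m where "m n = (\<Sum>j\<le>n. r j) / real (Suc n)" for n
  have "(\<Sum>n\<le>N. (m n)\<^sup>2 / 2 - 2 * (r n)\<^sup>2) \<le> - (real (Suc N) * (m N)\<^sup>2)"
  proof (induction N)
    case 0
    show ?case by (simp add: m_def)
  next
    case (Suc N)
    define k where "k = real (Suc N)"
    have k: "k > 0" by (simp add: k_def)
    have r: "r (Suc N) = (k + 1) * m (Suc N) - k * m N"
      by (simp add: m_def k_def)
    \<comment> \<open>one square from the telescoping bound, one from the bound on the mixed product\<close>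
    have "0 \<le> k * (m (Suc N) - m N)\<^sup>2 + (m (Suc N) - 2 * r (Suc N))\<^sup>2 / 2"
      using k by simp
    also have "\<dots> = - ((k + 1) * (m (Suc N))\<^sup>2) + k * (m N)\<^sup>2
        - ((m (Suc N))\<^sup>2 / 2 - 2 * (r (Suc N))\<^sup>2)"
      unfolding r by (simp add: power2_eq_square field_simps)
    finally show ?case
      using Suc.IH by (simp add: k_def add_ac)
  qed
  also have "\<dots> \<le> 0" by simp
  finally show ?thesis
    by (simp add: m_def sum_subtractf flip: sum_divide_distrib sum_distrib_left)
qed

lemma hardy:
  fixes f :: "nat \<Rightarrow> 'a::real_normed_vector"
  shows "(\<Sum>n\<le>N. (norm (\<Sum>j\<le>n. f j) / real (Suc n))\<^sup>2) \<le> 4 * (\<Sum>n\<le>N. (norm (f n))\<^sup>2)"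
proof -
  have "(\<Sum>n\<le>N. (norm (\<Sum>j\<le>n. f j) / real (Suc n))\<^sup>2)
      \<le> (\<Sum>n\<le>N. ((\<Sum>j\<le>n. norm (f j)) / real (Suc n))\<^sup>2)"
    by (intro sum_mono power_mono divide_right_mono norm_sum) auto
  also have "\<dots> \<le> 4 * (\<Sum>n\<le>N. (norm (f n))\<^sup>2)" by (rule hardy_real)
  finally show ?thesis .
qed

section \<open>Terraced matrices with concave reciprocal\<close>

text \<open>
  The assumption \<open>initial\<close> is \<open>concave\<close> at the index \<open>-1\<close> under the convention \<open>b (-1) = 0\<close>. The
  lower bound \<open>d\<close> on the increments forces \<open>a n = O(1 / n)\<close>, hence boundedness of the operator.
\<close>

locale concave_reciprocal =
  fixes b :: "nat \<Rightarrow> real" and d :: real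
  assumes d_pos: "0 < d"
    and increment_ge: "d \<le> b (Suc n) - b n"
    and concave: "b (Suc (Suc n)) - b (Suc n) \<le> b (Suc n) - b n"
    and initial: "b 1 \<le> 2 * b 0"
begin

definition a :: "nat \<Rightarrow> real" where "a n = 1 / b n"

definition M :: "(nat \<Rightarrow> complex) \<Rightarrow> nat \<Rightarrow> complex" where
  "M f n = complex_of_real (a n) * (\<Sum>j\<le>n. f j)"

text \<open>
  For \<open>f \<in> ell2\<close> the tail sums \<open>Mstar f\<close> are the adjoint of \<open>M\<close> at \<open>f\<close>. That they are again in
  \<open>ell2\<close> is only a consequence of the main estimate.
\<close>

definition Mstar :: "(nat \<Rightarrow> complex) \<Rightarrow> nat \<Rightarrow> complex" where
  "Mstar f n = (\<Sum>k. complex_of_real (a (k + n)) * f (k + n))"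

text \<open>
  The quotient of \<open>b n\<close> by its last increment. The value at \<open>0\<close> follows the same rule with
  \<open>b (-1) = 0\<close>.
\<close>

definition weight :: "nat \<Rightarrow> real" where
  "weight n = (case n of 0 \<Rightarrow> 1 | Suc m \<Rightarrow> b (Suc m) / (b (Suc m) - b m))"

lemma increment_pos: "b n < b (Suc n)"
  using increment_ge[of n] d_pos by simp

lemma increment_le: "b (Suc n) - b n \<le> b 0"
proof (induction n)
  case 0
  show ?case using initial by simp
next
  case (Suc n)
  then show ?case using concave[of n] by linarith
qed

lemma b_ge: "d * real (Suc n) \<le> b n"
proof (induction n)
  case 0
  show ?case using increment_ge[of 0] increment_le[of 0] by simp
next
  case (Suc n)
  then show ?case using increment_ge[of n] by (simp add: algebra_simps)
qed

lemma b_le: "b n \<le> b 0 * real (Suc n)"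
proof (induction n)
  case (Suc n)
  then show ?case using increment_le[of n] by (simp add: algebra_simps)
qed simp

lemma b_pos: "0 < b n"
  by (rule less_le_trans[OF _ b_ge]) (use d_pos in simp)

lemma a_pos: "0 < a n"
  by (simp add: a_def b_pos)

lemma a_le: "a n \<le> (1 / d) / real (Suc n)"
proof -
  have "0 < d * real (Suc n)" using d_pos by simp
  from divide_left_mono[OF b_ge[of n] zero_le_one] this b_pos[of n] show ?thesis
    by (simp add: a_def)
qed

text \<open>
  This is where concavity is used: \<open>weight (Suc n) - 1\<close> is \<open>b n\<close> divided by the increment after
  \<open>n\<close>, while \<open>weight n\<close> is \<open>b n\<close> divided by the increment before \<open>n\<close>, which is at least as
  large.
\<close>

lemma weight_le_next: "weight n + 1 \<le> weight (Suc n)"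
proof -
  have *: "weight (Suc n) = 1 + b n / (b (Suc n) - b n)"
    using increment_pos[of n] by (simp add: weight_def field_simps)
  have "weight n \<le> b n / (b (Suc n) - b n)"
  proof (cases n)
    case 0
    then show ?thesis using initial increment_pos[of 0] by (simp add: weight_def field_simps)
  next
    case (Suc m)
    then show ?thesis
      using concave[of m] increment_pos[of "Suc m"] b_pos[of "Suc m"] increment_pos[of m]
      by (auto simp: weight_def intro!: divide_left_mono)
  qed
  with * show ?thesis by simp
qed

lemma weight_Suc: "weight (Suc n) = b (Suc n) / (b (Suc n) - b n)"
  by (simp add: weight_def)

lemma weight_linear: "weight n \<le> b 0 / d * real (Suc n)"
proof (cases n)
  case 0
  have "d \<le> b 0" using b_ge[of 0] by simp
  then show ?thesis using 0 d_pos by (simp add: weight_def)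
next
  case (Suc m)
  have "weight n \<le> b n / d"
    using Suc increment_ge[of m] b_pos[of n] d_pos increment_pos[of m]
    by (auto simp: weight_def intro!: divide_left_mono)
  also have "\<dots> \<le> (b 0 * real (Suc n)) / d"
    using b_le[of n] d_pos by (intro divide_right_mono) auto
  finally show ?thesis by simp
qed

text \<open>
  With \<open>weight (Suc n) - 1\<close> in place of \<open>weight n\<close> the two sides differ exactly by
  \<open>a n * (a n - a (Suc n)) * (cmod s)\<^sup>2\<close>. The coefficients of \<open>(cmod v)\<^sup>2\<close> agree
  trivially, and those of the mixed term agree because
  \<open>weight (Suc n) * a (Suc n) = (weight (Suc n) - 1) * a n\<close>, which determines the weight.
\<close>

lemma weighted_step:
  fixes v s :: complex
  shows "weight n * (cmod (v + a n * s))\<^sup>2 + (cmod v)\<^sup>2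
    \<le> (cmod (a n * s))\<^sup>2 + weight (Suc n) * (cmod (v + a (Suc n) * s))\<^sup>2"
proof -
  define W where "W = weight (Suc n)"
  have expand: "(cmod (v + complex_of_real t * s))\<^sup>2
      = (cmod v)\<^sup>2 + 2 * t * Re (v * cnj s) + t\<^sup>2 * (cmod s)\<^sup>2" for t
    by (simp add: cmod_power2) (simp add: power2_eq_square algebra_simps)
  have W: "W * a (Suc n) = (W - 1) * a n"
    using increment_pos[of n] b_pos[of n] b_pos[of "Suc n"]
    by (simp add: W_def weight_Suc a_def field_simps)
  have le: "a (Suc n) \<le> a n"
    using increment_pos[of n] b_pos[of n] by (simp add: a_def frac_le)
  have sq: "W * (a (Suc n))\<^sup>2 - (W - 1) * (a n)\<^sup>2 + (a n)\<^sup>2 = a n * (a n - a (Suc n))"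
  proof -
    have "W * (a (Suc n))\<^sup>2 = (W - 1) * a n * a (Suc n)"
      using W by (simp add: power2_eq_square)
    also have "\<dots> = a n * (W * a (Suc n)) - a n * a (Suc n)"
      by (simp add: algebra_simps)
    also have "\<dots> = a n * ((W - 1) * a n) - a n * a (Suc n)"
      by (simp only: W)
    finally show ?thesis by (simp add: power2_eq_square algebra_simps)
  qed
  have "weight n * (cmod (v + a n * s))\<^sup>2 \<le> (W - 1) * (cmod (v + a n * s))\<^sup>2"
    using weight_le_next[of n] by (intro mult_right_mono) (auto simp: W_def)
  also have "\<dots> + (cmod v)\<^sup>2 + a n * (a n - a (Suc n)) * (cmod s)\<^sup>2
      = (cmod (a n * s))\<^sup>2 + W * (cmod (v + a (Suc n) * s))\<^sup>2"
  proof -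
    have "(W - 1) * ((cmod v)\<^sup>2 + 2 * a n * Re (v * cnj s) + (a n)\<^sup>2 * (cmod s)\<^sup>2)
        + (cmod v)\<^sup>2 + a n * (a n - a (Suc n)) * (cmod s)\<^sup>2
      = W * (cmod v)\<^sup>2 + 2 * ((W - 1) * a n) * Re (v * cnj s)
        + ((W - 1) * (a n)\<^sup>2 + a n * (a n - a (Suc n))) * (cmod s)\<^sup>2"
      by (simp add: algebra_simps)
    also have "\<dots> = W * (cmod v)\<^sup>2 + 2 * (W * a (Suc n)) * Re (v * cnj s)
        + ((a n)\<^sup>2 + W * (a (Suc n))\<^sup>2) * (cmod s)\<^sup>2"
      by (simp add: W flip: sq)
    also have "\<dots> = (cmod (a n * s))\<^sup>2
        + W * ((cmod v)\<^sup>2 + 2 * a (Suc n) * Re (v * cnj s) + (a (Suc n))\<^sup>2 * (cmod s)\<^sup>2)"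
      by (simp add: norm_mult power_mult_distrib algebra_simps)
    finally show ?thesis by (simp only: expand)
  qed
  moreover have "0 \<le> a n * (a n - a (Suc n)) * (cmod s)\<^sup>2"
    using le a_pos[of n] by simp
  ultimately show ?thesis by (simp add: W_def)
qed

text \<open>
  Only the differences of \<open>t\<close> are prescribed, so that a constant may be subtracted from the tail
  sums. Choosing the constant with \<open>t (Suc n) = 0\<close> amounts to replacing \<open>f\<close> by its truncation
  to the indices up to \<open>n\<close>.
\<close>

lemma weighted_inequality:
  fixes t f :: "nat \<Rightarrow> complex"
  assumes t: "\<And>n. t n - t (Suc n) = a n * f n"
  shows "(\<Sum>j\<le>n. (cmod (t j))\<^sup>2)
    \<le> (\<Sum>j<n. (cmod (M f j))\<^sup>2) + weight n * (cmod (t (Suc n) + M f n))\<^sup>2"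
proof (induction n)
  case 0
  have "t 0 = t (Suc 0) + M f 0"
    using t[of 0] by (simp add: M_def algebra_simps)
  then show ?case by (simp add: weight_def)
next
  case (Suc n)
  have "t (Suc (Suc n)) + M f (Suc n) = t (Suc n) + a (Suc n) * (\<Sum>j\<le>n. f j)"
    using t[of "Suc n"] by (simp add: M_def algebra_simps)
  then show ?case
    using Suc weighted_step[of n "t (Suc n)" "\<Sum>j\<le>n. f j"] by (simp add: M_def)
qed

section \<open>The operator and its adjoint\<close>

lemma M_partial_sums_le:
  "(\<Sum>n\<le>N. (cmod (M f n))\<^sup>2) \<le> 4 / d\<^sup>2 * (\<Sum>n\<le>N. (cmod (f n))\<^sup>2)"
proof -
  have "(\<Sum>n\<le>N. (cmod (M f n))\<^sup>2)
      \<le> (\<Sum>n\<le>N. ((1 / d) * (cmod (\<Sum>j\<le>n. f j) / real (Suc n)))\<^sup>2)"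
  proof (intro sum_mono power_mono)
    fix n
    have "cmod (M f n) = a n * cmod (\<Sum>j\<le>n. f j)"
      using a_pos[of n] by (simp add: M_def norm_mult)
    also have "\<dots> \<le> (1 / d) / real (Suc n) * cmod (\<Sum>j\<le>n. f j)"
      by (intro mult_right_mono a_le) auto
    finally show "cmod (M f n) \<le> (1 / d) * (cmod (\<Sum>j\<le>n. f j) / real (Suc n))"
      by simp
  qed auto
  also have "\<dots> = (1 / d)\<^sup>2 * (\<Sum>n\<le>N. (cmod (\<Sum>j\<le>n. f j) / real (Suc n))\<^sup>2)"
    by (simp only: power_mult_distrib sum_distrib_left)
  also have "\<dots> \<le> (1 / d)\<^sup>2 * (4 * (\<Sum>n\<le>N. (cmod (f n))\<^sup>2))"
    by (intro mult_left_mono hardy) auto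
  finally show ?thesis by (simp add: power_divide)
qed

lemma
  assumes "f \<in> ell2"
  shows M_ell2: "M f \<in> ell2"
    and M_sum_le: "(\<Sum>n. (cmod (M f n))\<^sup>2) \<le> 4 / d\<^sup>2 * (\<Sum>n. (cmod (f n))\<^sup>2)"
proof -
  have "(\<Sum>n\<le>N. (cmod (M f n))\<^sup>2) \<le> 4 / d\<^sup>2 * (\<Sum>n. (cmod (f n))\<^sup>2)" for N
    by (rule order_trans[OF M_partial_sums_le])
       (use assms in \<open>auto simp: ell2_def intro!: divide_right_mono mult_left_mono sum_le_suminf\<close>)
  from ell2_bounded_partial_sums[OF this] show "M f \<in> ell2"
    "(\<Sum>n. (cmod (M f n))\<^sup>2) \<le> 4 / d\<^sup>2 * (\<Sum>n. (cmod (f n))\<^sup>2)" by auto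
qed

lemma bounded_operator_M: "ell2_bounded_operator M"
  unfolding ell2_bounded_operator_def
proof (intro conjI ballI allI exI)
  fix f assume f: "f \<in> ell2"
  show "M f \<in> ell2" using f by (rule M_ell2)
  show "ell2_norm (M f) \<le> (2 / d) * ell2_norm f"
  proof -
    have "ell2_norm (M f) \<le> sqrt ((2 / d)\<^sup>2 * (\<Sum>n. (cmod (f n))\<^sup>2))"
      unfolding ell2_norm_def using M_sum_le[OF f] by (simp add: power_divide)
    also have "\<dots> = (2 / d) * ell2_norm f"
      using d_pos by (simp add: ell2_norm_def real_sqrt_mult real_sqrt_divide)
    finally show ?thesis .
  qed
  show "M (\<lambda>n. c * f n) = (\<lambda>n. c * M f n)" for c
    by (simp add: M_def fun_eq_iff mult_ac flip: sum_distrib_left)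
  fix g
  show "M (\<lambda>n. f n + g n) = (\<lambda>n. M f n + M g n)"
    by (simp add: M_def fun_eq_iff sum.distrib algebra_simps)
qed

lemma a_ell2: "(\<lambda>n. complex_of_real (a n)) \<in> ell2"
proof -
  have "summable (\<lambda>n. (1 / d)\<^sup>2 * (1 / (real (Suc n))\<^sup>2))"
    using inverse_squares_sums by (intro summable_mult) (auto simp: sums_iff)
  then have "summable (\<lambda>n. (a n)\<^sup>2)"
  proof (rule summable_comparison_test'[where N = 0])
    fix n
    have "(a n)\<^sup>2 \<le> ((1 / d) / real (Suc n))\<^sup>2"
      using a_pos[of n] by (intro power_mono a_le) auto
    then show "norm ((a n)\<^sup>2) \<le> (1 / d)\<^sup>2 * (1 / (real (Suc n))\<^sup>2)"
      by (simp add: power_divide power_mult_distrib)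
  qed
  then show ?thesis by (simp add: ell2_def)
qed

lemma
  fixes f :: "nat \<Rightarrow> complex"
  assumes "f \<in> ell2"
  shows Mstar_diff: "Mstar f n - Mstar f (Suc n) = a n * f n"
    and Mstar_tendsto_0: "Mstar f \<longlonglongrightarrow> 0"
proof -
  have summ: "summable (\<lambda>k. complex_of_real (a k) * f k)"
    using ell2_inner_summable[OF a_ell2 ell2_cnj[OF assms]] by simp
  have eq: "Mstar f n = (\<Sum>k. complex_of_real (a k) * f k) - (\<Sum>k<n. complex_of_real (a k) * f k)" for n
    using suminf_split_initial_segment[OF summ, of n] by (simp add: Mstar_def)
  show "Mstar f n - Mstar f (Suc n) = a n * f n"
    by (simp add: eq)
  have "(\<lambda>n. (\<Sum>k. complex_of_real (a k) * f k) - (\<Sum>k<n. complex_of_real (a k) * f k)) \<longlonglongrightarrow>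
      (\<Sum>k. complex_of_real (a k) * f k) - (\<Sum>k. complex_of_real (a k) * f k)"
    by (intro tendsto_diff tendsto_const summable_LIMSEQ summ)
  then show "Mstar f \<longlonglongrightarrow> 0" by (simp add: eq[abs_def])
qed

text \<open>
  The weighted inequality is applied to the tail sums of the truncation of \<open>f\<close> at \<open>N\<close>. For fixed
  \<open>J\<close> the left-hand side converges as \<open>N\<close> grows, so it suffices that the boundary term, which is
  \<open>O(N)\<close> times a term of a convergent series, is small for arbitrarily large \<open>N\<close>.
\<close>

lemma Mstar_partial_sums_le:
  assumes f: "f \<in> ell2"
  shows "(\<Sum>j\<le>J. (cmod (Mstar f j))\<^sup>2) \<le> (\<Sum>n. (cmod (M f n))\<^sup>2)"
proof (rule ccontr)
  define B where "B = (\<Sum>n. (cmod (M f n))\<^sup>2)"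
  assume "\<not> ?thesis"
  then have "B < (\<Sum>j\<le>J. (cmod (Mstar f j))\<^sup>2)" by (simp add: B_def)
  then obtain c where c: "B < c" "c < (\<Sum>j\<le>J. (cmod (Mstar f j))\<^sup>2)"
    using dense by blast
  define q where "q = b 0 / d"
  have q: "q > 0" using b_pos[of 0] d_pos by (simp add: q_def)
  have summ: "summable (\<lambda>n. (cmod (M f n))\<^sup>2)"
    using M_ell2[OF f] by (simp add: ell2_def)
  have "(\<lambda>N. \<Sum>j\<le>J. (cmod (Mstar f j - Mstar f (Suc N)))\<^sup>2)
      \<longlonglongrightarrow> (\<Sum>j\<le>J. (cmod (Mstar f j - 0))\<^sup>2)"
    by (intro tendsto_sum tendsto_power tendsto_norm tendsto_diff tendsto_const
        Mstar_tendsto_0[OF f, THEN LIMSEQ_Suc])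
  then have "\<forall>\<^sub>F N in sequentially. c < (\<Sum>j\<le>J. (cmod (Mstar f j - Mstar f (Suc N)))\<^sup>2)"
    using c by (intro order_tendstoD) auto
  then obtain N0 where N0:
    "\<And>N. N \<ge> N0 \<Longrightarrow> c < (\<Sum>j\<le>J. (cmod (Mstar f j - Mstar f (Suc N)))\<^sup>2)"
    by (auto simp: eventually_sequentially)
  obtain N where N: "N \<ge> max N0 J" "real (Suc N) * (cmod (M f N))\<^sup>2 < (c - B) / q"
    using summable_weighted_infimum_0[OF summ, of "(c - B) / q" "max N0 J"] c q by auto
  have "c < (\<Sum>j\<le>J. (cmod (Mstar f j - Mstar f (Suc N)))\<^sup>2)"
    using N by (intro N0) simp
  also have "\<dots> \<le> (\<Sum>j\<le>N. (cmod (Mstar f j - Mstar f (Suc N)))\<^sup>2)"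
    using N by (intro sum_mono2) auto
  also have "\<dots> \<le> (\<Sum>j<N. (cmod (M f j))\<^sup>2) + weight N * (cmod (M f N))\<^sup>2"
    using weighted_inequality[of "\<lambda>j. Mstar f j - Mstar f (Suc N)" f N]
    by (simp add: Mstar_diff[OF f])
  also have "\<dots> \<le> B + q * (real (Suc N) * (cmod (M f N))\<^sup>2)"
    unfolding B_def mult.assoc[symmetric] q_def
    by (intro add_mono sum_le_suminf summ mult_right_mono weight_linear) auto
  also have "\<dots> < B + q * ((c - B) / q)"
    using N q by (intro add_strict_left_mono mult_strict_left_mono) auto
  also have "\<dots> = c" using q by simp
  finally show False by simp
qed

lemma
  assumes "f \<in> ell2"
  shows Mstar_ell2: "Mstar f \<in> ell2"
    and Mstar_sum_le: "(\<Sum>n. (cmod (Mstar f n))\<^sup>2) \<le> (\<Sum>n. (cmod (M f n))\<^sup>2)"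
  using ell2_bounded_partial_sums[OF Mstar_partial_sums_le[OF assms]] by auto

lemma summation_by_parts:
  assumes g: "g \<in> ell2"
  shows "(\<Sum>n\<le>N. M f n * cnj (g n))
    = (\<Sum>n\<le>N. f n * cnj (Mstar g n)) - (\<Sum>j\<le>N. f j) * cnj (Mstar g (Suc N))"
proof (induction N)
  case 0
  have "cnj (Mstar g 0) - cnj (Mstar g (Suc 0)) = a 0 * cnj (g 0)"
    using arg_cong[OF Mstar_diff[OF g, of 0], of cnj] by simp
  then show ?case by (simp add: M_def algebra_simps flip: right_diff_distrib)
next
  case (Suc N)
  have "cnj (Mstar g (Suc N)) = a (Suc N) * cnj (g (Suc N)) + cnj (Mstar g (Suc (Suc N)))"
    using arg_cong[OF Mstar_diff[OF g, of "Suc N"], of cnj] by (simp add: algebra_simps)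
  then show ?case using Suc by (simp add: M_def algebra_simps)
qed

text \<open>
  Both inner products converge, so the boundary term of the summation by parts has a limit, and the
  limit can be identified along a subsequence. Since the partial sum of \<open>f\<close> is \<open>b N * M f N\<close> and
  \<open>b\<close> grows at most linearly, the boundary term is \<open>O(N)\<close> times \<open>|M f N| |Mstar g (N + 1)|\<close>, a
  term of a convergent series.
\<close>

lemma inner_M_Mstar:
  assumes f: "f \<in> ell2" and g: "g \<in> ell2"
  shows "ell2_inner (M f) g = ell2_inner f (Mstar g)"
proof (rule ccontr)
  assume neq: "\<not> ?thesis"
  define r where "r N = (\<Sum>j\<le>N. f j) * cnj (Mstar g (Suc N))" for N
  define e where "e = cmod (ell2_inner f (Mstar g) - ell2_inner (M f) g)"
  have e: "e > 0" using neq by (simp add: e_def)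
  have "r = (\<lambda>N. (\<Sum>n\<le>N. f n * cnj (Mstar g n)) - (\<Sum>n\<le>N. M f n * cnj (g n)))"
    by (simp add: fun_eq_iff r_def summation_by_parts[OF g])
  moreover have "(\<lambda>N. (\<Sum>n\<le>N. f n * cnj (Mstar g n)) - (\<Sum>n\<le>N. M f n * cnj (g n)))
      \<longlonglongrightarrow> ell2_inner f (Mstar g) - ell2_inner (M f) g"
    unfolding ell2_inner_def
    by (intro tendsto_diff summable_LIMSEQ' ell2_inner_summable f g M_ell2 Mstar_ell2)
  ultimately have "r \<longlonglongrightarrow> ell2_inner f (Mstar g) - ell2_inner (M f) g" by simp
  then have "(\<lambda>N. cmod (r N)) \<longlonglongrightarrow> e"
    unfolding e_def by (rule tendsto_norm)
  then have "\<forall>\<^sub>F N in sequentially. e / 2 < cmod (r N)"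
    using e by (intro order_tendstoD) auto
  then obtain N0 where N0: "\<And>N. N \<ge> N0 \<Longrightarrow> e / 2 < cmod (r N)"
    by (auto simp: eventually_sequentially)
  define u where "u N = cmod (M f N) * cmod (Mstar g (Suc N))" for N
  have "(\<lambda>N. Mstar g (Suc N)) \<in> ell2"
    using Mstar_ell2[OF g] unfolding ell2_def mem_Collect_eq by (subst summable_Suc_iff)
  then have "(\<lambda>N. complex_of_real (cmod (M f N))) \<in> ell2"
      "(\<lambda>N. complex_of_real (cmod (Mstar g (Suc N)))) \<in> ell2"
    using M_ell2[OF f] by (auto simp: ell2_def)
  from ell2_inner_summable[OF this] have "summable (\<lambda>N. complex_of_real (u N))"
    by (simp add: u_def)
  then have "summable u" by (simp only: summable_of_real_iff)
  then obtain N where N: "N \<ge> N0" "real (Suc N) * u N < e / 2 / b 0"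
    using summable_weighted_infimum_0[of u "e / 2 / b 0" N0] e b_pos[of 0] by (auto simp: u_def)
  have "(\<Sum>j\<le>N. f j) = b N * M f N"
    using b_pos[of N] by (simp add: M_def a_def)
  then have "cmod (r N) = b N * u N"
    using b_pos[of N] by (simp add: r_def u_def norm_mult)
  also have "\<dots> \<le> b 0 * (real (Suc N) * u N)"
    unfolding mult.assoc[symmetric] by (intro mult_right_mono b_le) (simp add: u_def)
  also have "\<dots> < e / 2"
    using N b_pos[of 0] by (simp add: field_simps)
  finally show False using N0[OF N(1)] by simp
qed

lemma adjoint_M:
  assumes "g \<in> ell2" shows "ell2_adjoint M g = Mstar g"
  unfolding ell2_adjoint_def
proof (rule the_equality)
  show "Mstar g \<in> ell2 \<and> (\<forall>f\<in>ell2. ell2_inner (M f) g = ell2_inner f (Mstar g))"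
    using assms by (simp add: Mstar_ell2 inner_M_Mstar)
  then show "h = Mstar g"
    if "h \<in> ell2 \<and> (\<forall>f\<in>ell2. ell2_inner (M f) g = ell2_inner f h)" for h
    using that ell2_adjoint_unique[of M g h "Mstar g"] by blast
qed

theorem hyponormal_M: "ell2_hyponormal M"
  unfolding ell2_hyponormal_def
proof (intro conjI ballI bounded_operator_M)
  fix f assume f: "f \<in> ell2"
  note [simp] = f M_ell2 Mstar_ell2
  have "ell2_inner (Mstar (M f)) f = cnj (ell2_inner (M f) (M f))"
    by (simp add: ell2_inner_cnj[of f "Mstar (M f)"] inner_M_Mstar)
  also have "\<dots> = complex_of_real (\<Sum>n. (cmod (M f n))\<^sup>2)"
    by (simp add: ell2_inner_self)
  finally have 1: "ell2_inner (Mstar (M f)) f = complex_of_real (\<Sum>n. (cmod (M f n))\<^sup>2)" .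
  have 2: "ell2_inner (M (Mstar f)) f = complex_of_real (\<Sum>n. (cmod (Mstar f n))\<^sup>2)"
    by (simp add: inner_M_Mstar ell2_inner_self)
  have "ell2_inner (\<lambda>n. ell2_adjoint M (M f) n - M (ell2_adjoint M f) n) f
      = complex_of_real ((\<Sum>n. (cmod (M f n))\<^sup>2) - (\<Sum>n. (cmod (Mstar f n))\<^sup>2))"
    by (simp add: adjoint_M ell2_inner_diff_left 1 2)
  then show "ell2_inner (\<lambda>n. ell2_adjoint M (M f) n - M (ell2_adjoint M f) n) f \<in> \<real>\<^sub>\<ge>\<^sub>0"
    using Mstar_sum_le[OF f] by (simp del: of_real_diff)
qed

end

section \<open>The logarithmic sequence\<close>

lemma ln_step_pos: "0 < ln (x + 1) - ln x" if "0 < x" for x :: real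
  using that by simp

lemma ln_step_derivative:
  fixes x :: real
  assumes "0 < x"
  shows "((\<lambda>x. ln (x + 1) - ln x) has_real_derivative - 1 / (x * (x + 1))) (at x)"
  using assms by (auto intro!: derivative_eq_intros simp: field_simps)

text \<open>
  With \<open>L = ln (x + 1) - ln x\<close> the derivative of \<open>x (x + 1) L\<^sup>2\<close> is \<open>L ((2 x + 1) L - 2)\<close>, so the
  claim is the midpoint estimate \<open>L \<ge> 1 / (x + 1/2)\<close> for the integral of the convex function
  \<open>1/x\<close> over an interval of length \<open>1\<close>.
\<close>

lemma mono_ln_step_product:
  fixes x y :: real
  assumes "0 < x" "x \<le> y"
  shows "x * (x + 1) * (ln (x + 1) - ln x)\<^sup>2 \<le> y * (y + 1) * (ln (y + 1) - ln y)\<^sup>2"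
proof (rule DERIV_nonneg_imp_nondecreasing[OF assms(2)])
  fix z assume "x \<le> z" "z \<le> y"
  then have z: "0 < z" using assms by simp
  define L where "L = ln (z + 1) - ln z"
  have "L \<ge> 2 / (2 * z + 1)"
    using ln_inverse_approx_ge[OF z, of "z + 1"] by (simp add: L_def add_ac)
  then have "0 \<le> (2 * z + 1) * L - 2"
    using z by (simp add: field_simps)
  moreover have "0 < L" using z by (simp add: L_def)
  moreover have "((\<lambda>x. x * (x + 1) * (ln (x + 1) - ln x)\<^sup>2)
      has_real_derivative L * ((2 * z + 1) * L - 2)) (at z)"
  proof -
    have "((\<lambda>x. x * (x + 1)) has_real_derivative 2 * z + 1) (at z)"
      by (auto intro!: derivative_eq_intros)
    moreover have "((\<lambda>x. (ln (x + 1) - ln x)\<^sup>2)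
        has_real_derivative 2 * L * (- 1 / (z * (z + 1)))) (at z)"
      using DERIV_power[OF ln_step_derivative[OF z], of 2] by (simp add: L_def mult_ac)
    ultimately have "((\<lambda>x. x * (x + 1) * (ln (x + 1) - ln x)\<^sup>2) has_real_derivative
        (2 * z + 1) * L\<^sup>2 + 2 * L * (- 1 / (z * (z + 1))) * (z * (z + 1))) (at z)"
      unfolding L_def by (rule DERIV_mult)
    moreover have "2 * L * (- 1 / (z * (z + 1))) * (z * (z + 1)) = - 2 * L"
      using z by simp
    ultimately show ?thesis by (simp add: power2_eq_square algebra_simps)
  qed
  ultimately show "\<exists>D. ((\<lambda>x. x * (x + 1) * (ln (x + 1) - ln x)\<^sup>2) has_real_derivative D) (at z)
      \<and> 0 \<le> D"
    by (intro exI[of _ "L * ((2 * z + 1) * L - 2)"]) auto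
qed

lemma reciprocal_ln_step_concave:
  "concave_on {0<..} (\<lambda>x::real. 1 / (ln (x + 1) - ln x))"
  unfolding concave_on_def
proof (rule convex_on_realI)
  show "((\<lambda>x. - (1 / (ln (x + 1) - ln x))) has_real_derivative
      - 1 / (x * (x + 1) * (ln (x + 1) - ln x)\<^sup>2)) (at x)" if "x \<in> {0<..}" for x :: real
    using that ln_step_pos[of x]
    by (auto intro!: derivative_eq_intros ln_step_derivative simp: field_simps power2_eq_square)
  fix x y :: real
  assume "x \<in> {0<..}" "y \<in> {0<..}" "x \<le> y"
  then show "- 1 / (x * (x + 1) * (ln (x + 1) - ln x)\<^sup>2)
      \<le> - 1 / (y * (y + 1) * (ln (y + 1) - ln y)\<^sup>2)"
    using mono_ln_step_product[of x y] ln_step_pos[of x]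
    by (auto intro!: divide_left_mono mult_pos_pos)
qed auto

text \<open>
  If \<open>A\<close> and \<open>B\<close> are consecutive logarithmic steps, then \<open>1/B - 1/A = (A - B) / (A B)\<close>, where
  \<open>A B\<close> is at most \<open>1 / (x (x + 1))\<close> and \<open>A - B = - ln (1 - 1 / (x + 1)\<^sup>2)\<close> is at least
  \<open>1 / (x + 1)\<^sup>2\<close>.
\<close>

lemma reciprocal_ln_step_increment:
  fixes x :: real
  assumes "1 \<le> x"
  shows "1 / 2 \<le> 1 / (ln (x + 2) - ln (x + 1)) - 1 / (ln (x + 1) - ln x)"
proof -
  define A where "A = ln (x + 1) - ln x"
  define B where "B = ln (x + 2) - ln (x + 1)"
  have pos: "0 < A" "0 < B" using assms by (auto simp: A_def B_def)
  have "A \<le> 1 / x" "B \<le> 1 / (x + 1)"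
    using ln_diff_le[of "x + 1" x] ln_diff_le[of "x + 2" "x + 1"] assms
    by (auto simp: A_def B_def)
  then have "A * B \<le> 1 / x * (1 / (x + 1))"
    using pos assms by (intro mult_mono) auto
  also have "\<dots> \<le> 2 / (x + 1)\<^sup>2"
  proof -
    have "(x + 1)\<^sup>2 \<le> 2 * (x * (x + 1))"
      using assms mult_mono[of 1 x 1 x] by (simp add: power2_eq_square algebra_simps)
    then have "2 / (2 * (x * (x + 1))) \<le> 2 / (x + 1)\<^sup>2"
      using assms by (intro frac_le) auto
    then show ?thesis by simp
  qed
  finally have AB: "A * B \<le> 2 / (x + 1)\<^sup>2" .
  have "1 / (x + 1)\<^sup>2 \<le> A - B"
  proof -
    have "ln (x * (x + 2)) - ln ((x + 1)\<^sup>2) \<le> (x * (x + 2) - (x + 1)\<^sup>2) / (x + 1)\<^sup>2"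
      using assms by (intro ln_diff_le) auto
    moreover have "x * (x + 2) - (x + 1)\<^sup>2 = -1"
      by (simp add: power2_eq_square algebra_simps)
    ultimately show ?thesis
      using assms by (simp add: A_def B_def ln_mult ln_realpow)
  qed
  with AB have "A * B \<le> 2 * (A - B)" by simp
  then have "1 / 2 \<le> (A - B) / (A * B)"
    using pos by (simp add: field_simps)
  also have "\<dots> = 1 / B - 1 / A"
    using pos by (simp add: field_simps)
  finally show ?thesis by (simp add: A_def B_def)
qed

lemma concave_reciprocal_ln:
  "concave_reciprocal (\<lambda>n. 1 / ln (1 + 1 / (real n + 1))) (1 / 2)"
proof -
  define F where "F x = 1 / (ln (x + 1) - ln x)" for x :: real
  have F: "1 / ln (1 + 1 / (real n + 1)) = F (real n + 1)" for n
  proof -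
    have "1 + 1 / (real n + 1) = (real n + 1 + 1) / (real n + 1)"
      by (simp add: field_simps)
    then show ?thesis by (simp only: F_def) (simp add: ln_div)
  qed
  show ?thesis
    unfolding F
  proof
    fix n
    show "1 / 2 \<le> F (real (Suc n) + 1) - F (real n + 1)"
      using reciprocal_ln_step_increment[of "real n + 1"] by (simp add: F_def add_ac)
    have "convex_on {0<..} (\<lambda>x. - F x)"
      using reciprocal_ln_step_concave by (simp add: concave_on_def F_def)
    from convex_onD[OF this, of "1 / 2" "real n + 1" "real n + 3"]
    have "F (real n + 1) / 2 + F (real n + 3) / 2 \<le> F (real n + 2)"
      by (simp add: add_divide_distrib)
    then show "F (real (Suc (Suc n)) + 1) - F (real (Suc n) + 1)
        \<le> F (real (Suc n) + 1) - F (real n + 1)"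
      by (simp add: add_ac)
  next
    \<comment> \<open>the initial condition reads \<open>ln 2 \<le> 2 ln (3/2) = ln (9/4)\<close>\<close>
    have "ln 2 \<le> ln ((3 / 2 :: real)\<^sup>2)"
      by (subst ln_le_cancel_iff) (auto simp: power2_eq_square)
    also have "\<dots> = 2 * (ln 3 - ln 2)"
      by (simp add: ln_realpow ln_div)
    finally show "F (real 1 + 1) \<le> 2 * F (real 0 + 1)"
      by (simp add: F_def field_simps)
  qed simp
qed

theorem proposition1:
  fixes a :: "nat \<Rightarrow> complex"
  assumes "\<And>n. a n = complex_of_real (ln (1 + 1 / (real n + 1)))"
  shows "ell2_hyponormal (matrix_op (terraced_matrix a))"
proof -
  interpret L: concave_reciprocal "\<lambda>n. 1 / ln (1 + 1 / (real n + 1))" "1 / 2"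
    by (rule concave_reciprocal_ln)
  have "matrix_op (terraced_matrix a) = L.M"
    by (simp add: fun_eq_iff matrix_op_terraced_matrix L.M_def L.a_def assms)
  then show ?thesis using L.hyponormal_M by simp
qed

end
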